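(* Let $r,s \in \mathbb{Z}$, $N,D \in \mathbb{N}$ with $(D,N)=1$, and let $\psi$ and $\chi$ be Dirichlet characters modulo $N$ and $D$, respectively. Let $F\in\mathcal{M}^!_{r,s}(\Gamma_0(N), \psi)$ have an expansion of the form $$F(z) = \sum_{k\in S} \sum_{n\geq n_0} y^k a_n^{(k)} q^n + \sum_{k\in S} \sum_{n\geq n_0} y^k b_n^{(k)} \bar{q}^n$$ with $S\subset\mathbb{Z}$ finite, $n_0\in\mathbb{Z}$, and with $a_n^{(k)},b_n^{(k)}\ll e^{Cn^{1/t}}$ (as $n\to\infty$) for all $k\in S$ and some constants $C>0$ and $t>1$. Suppose that $G := F||_{r,s} W_N$ has an expansion of the same form with coefficients satisfying bounds of the same form. Define $$\mathcal{F}_{F,G} := \bigcap_{\chi'\bmod D}\left\{\varphi\in\mathcal{F}_{F_{\chi'}}:\varphi|_{2-r-s} W_N\in\mathcal{F}_{G_{\overline{\chi'}}}\right\},$$ the intersection being over all Dirichlet characters $\chi'$ modulo $D$. Then $\mathcal{F}_{F,G}$ is non-empty and, for every $\varphi \in \mathcal{F}_{F,G}$, $$L_{F_\chi}(\varphi) = \frac{i^{r-s}\chi(-N)\psi(D)}{N^{\frac{r+s-2}{2}}} L_{G_{\bar\chi}}(\varphi|_{2-r-s} W_N).$$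
   Context: Notation: $z=x+iy\in\mathbb{H}$, $q=e^{2\pi iz}$, $\mathbb{R}_+=(0,\infty)$. For $\gamma=\begin{pmatrix}a&b\\c&d\end{pmatrix}\in GL^+(2,\mathbb{R})$ (positive determinant), $j(\gamma,z)=cz+d$ and for $f:\mathbb{H}\to\mathbb{C}$, $$(f||_{r,s}\gamma)(z)=\det(\gamma)^{\frac{r+s}{2}}j(\gamma,z)^{-r}j(\gamma,\bar z)^{-s}f(\gamma z).$$ $W_N=\begin{pmatrix}0&-N^{-1/2}\\N^{1/2}&0\end{pmatrix}$; for $\varphi:\mathbb{R}_+\to\mathbb{C}$ and $a\in\mathbb{Z}$, $(\varphi|_aW_N)(x)=(Nx)^{-a}\varphi(1/(Nx))$. $\mathcal{M}^!_{r,s}(\Gamma_0(N),\psi)$ is the space of real-analytic $F:\mathbb{H}\to\mathbb{C}$ such that (i) $F(\gamma z)=\psi(d)j(\gamma,z)^rj(\gamma,\bar z)^sF(z)$ for all $\gamma=\begin{pmatrix}a&b\\c&d\end{pmatrix}\in\Gamma_0(N)$ and $z\in\mathbb{H}$; (ii) $F(z)=\sum_{|j|\le N_0}y^j\big(\sum_{m,n\ge-N_0'}a_{m,n}^{(j)}q^m\bar q^n\big)$ for some $N_0,N_0'\in\mathbb{N}$, $a_{m,n}^{(j)}\in\mathbb{C}$; (iii) for all $\gamma\in SL_2(\mathbb{Z})$ there is $C>0$ with $(F||_{r,s}\gamma)(x+iy)=O(e^{Cy})$ as $y\to\infty$, uniformly in $x$. (It is always assumed that $\psi(-1)=(-1)^{r+s}$.)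 Twist: for $H$ given by an expansion of the form $H(z)=\sum_{k\in S}\sum_{n\ge n_0}y^ka_n^{(k)}q^n+\sum_{k\in S}\sum_{n\ge n_0}y^kb_n^{(k)}\bar q^n$ (with $S\subset\mathbb{Z}$ finite, $n_0\in\mathbb{Z}$ and $a_n^{(k)},b_n^{(k)}\in\mathbb{C}$) and a Dirichlet character $\chi$ modulo $D$, $$H_\chi(z)=D^{(r+s)/2}\sum_{\mu\bmod D}\overline{\chi(\mu)}\left(H\Big|\Big|_{r,s}\begin{pmatrix}D^{-1/2}&\mu D^{-1/2}\\0&D^{1/2}\end{pmatrix}\right)(z)=\sum_{\mu\bmod D}\overline{\chi(\mu)}\,H\!\left(\frac{z+\mu}{D}\right).$$ If $H=\sum_{k,n}y^ka_n^{(k)}q^n+\sum_{k,n}y^kb_n^{(k)}\bar q^n$ then, with $\tau_\chi(n)=\sum_{\mu\bmod D}\chi(\mu)e^{2\pi in\mu/D}$, $$H_\chi(z)=\sum_{k,n}y^kD^{-k}\tau_{\bar\chi}(n)a_n^{(k)}q^{n/D}+\sum_{k,n}y^kD^{-k}\overline{\tau_\chi(n)}\,b_n^{(k)}\bar q^{n/D},$$ and this expansion is the one used for $H_\chi$, with $M=D$, in the definitions of the test function space $\mathcal{F}_{H_\chi}$ and the $L$-series $L_{H_\chi}$. Laplace transform: $(\mathcal{L}\varphi)(s)=\int_0^\infty e^{-st}\varphi(t)\,dt$; $\varphi_{k+1}(y)=y^k\varphi(y)$. For $H$ with expansion $H(z)=\sum_{k\in S}\sum_{n\ge n_0}y^k\alpha_n^{(k)}q^{n/M}+\sum_{k\in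 S}\sum_{n\ge n_0}y^k\beta_n^{(k)}\bar q^{n/M}$ ($M\in\mathbb{Z}_{>0}$, $S\subset\mathbb{Z}$ finite, $n_0\in\mathbb{Z}$), $\mathcal{F}_H$ is the space of piecewise smooth complex-valued functions $\varphi$ on $\mathbb{R}$ (only the values on $\mathbb{R}_+$ enter) such that the integral defining $(\mathcal{L}\varphi)(s)$ converges absolutely for all $s$ with $\mathrm{Re}(s)\ge2\pi n_0$ and $$\sum_{k\in S}\sum_{n\ge n_0}\left(|\alpha_n^{(k)}|+|\beta_n^{(k)}|\right)\mathcal{L}|\varphi_{k+1}|\left(\tfrac{2\pi n}{M}\right)<\infty.$$ For $\varphi\in\mathcal{F}_H$, $$L_H(\varphi)=\sum_{k\in S}\sum_{n\ge n_0}\alpha_n^{(k)}\mathcal{L}\varphi_{k+1}\left(\tfrac{2\pi n}{M}\right)+\sum_{k\in S}\sum_{n\ge n_0}\beta_n^{(k)}\mathcal{L}\varphi_{k+1}\left(\tfrac{2\pi n}{M}\right).$$ *)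

theory Defs
  imports "HOL-Analysis.Analysis" "HOL-Library.Landau_Symbols"
begin

section \<open>The slash action\<close>

abbreviation upper_half_plane :: "complex set"
  where "upper_half_plane \<equiv> {z. 0 < Im z}"

abbreviation mat2 :: "'a::zero \<Rightarrow> 'a \<Rightarrow> 'a \<Rightarrow> 'a \<Rightarrow> 'a ^ 2 ^ 2"
  where "mat2 a b c d \<equiv> vector [vector [a, b], vector [c, d]]"

definition mat_act :: "real ^ 2 ^ 2 \<Rightarrow> complex \<Rightarrow> complex"
  where "mat_act \<gamma> = moebius (of_real (\<gamma> $ 1 $ 1)) (of_real (\<gamma> $ 1 $ 2))
                            (of_real (\<gamma> $ 2 $ 1)) (of_real (\<gamma> $ 2 $ 2))"

definition aut_factor :: "real ^ 2 ^ 2 \<Rightarrow> complex \<Rightarrow> complex"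
  where "aut_factor \<gamma> z = of_real (\<gamma> $ 2 $ 1) * z + of_real (\<gamma> $ 2 $ 2)"

text \<open>Functions on the upper half-plane are total functions on the complex numbers of which only
  the values at points with positive imaginary part are used. The slash operator is only meant for
  matrices of positive determinant.\<close>

definition slash :: "int \<Rightarrow> int \<Rightarrow> real ^ 2 ^ 2 \<Rightarrow> (complex \<Rightarrow> complex) \<Rightarrow> complex \<Rightarrow> complex"
  where "slash r s \<gamma> f z =
    of_real (det \<gamma> powr (of_int (r + s) / 2)) * aut_factor \<gamma> z powi (- r)
      * aut_factor \<gamma> (cnj z) powi (- s) * f (mat_act \<gamma> z)"

definition Fricke :: "nat \<Rightarrow> real ^ 2 ^ 2"
  where "Fricke N = mat2 0 (- (real N powr (- 1 / 2))) (real N powr (1 / 2)) 0"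

definition slash_Fricke :: "int \<Rightarrow> nat \<Rightarrow> (real \<Rightarrow> complex) \<Rightarrow> real \<Rightarrow> complex"
  where "slash_Fricke a N \<phi> x = of_real (real N * x) powi (- a) * \<phi> (1 / (real N * x))"

definition Gamma0 :: "nat \<Rightarrow> (int ^ 2 ^ 2) set"
  where "Gamma0 N = {\<gamma>. det \<gamma> = 1 \<and> int N dvd \<gamma> $ 2 $ 1}"

definition SL2Z :: "(int ^ 2 ^ 2) set"
  where "SL2Z = {\<gamma>. det \<gamma> = 1}"

section \<open>Dirichlet characters\<close>

text \<open>Characters modulo n are not assumed to be primitive. For the modulus 1 the only one is the
  constant function 1; in particular it takes the value 1 at 0.\<close>

definition dirichlet_character :: "nat \<Rightarrow> (int \<Rightarrow> complex) \<Rightarrow> bool"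
  where "dirichlet_character n \<omega> \<longleftrightarrow>
    n > 0 \<and> (\<forall>a. \<omega> (a + int n) = \<omega> a) \<and> (\<forall>a b. \<omega> (a * b) = \<omega> a * \<omega> b) \<and>
    (\<forall>a. \<omega> a \<noteq> 0 \<longleftrightarrow> coprime a (int n))"

abbreviation conj_character :: "(int \<Rightarrow> complex) \<Rightarrow> int \<Rightarrow> complex"
  where "conj_character \<omega> \<equiv> \<lambda>a. cnj (\<omega> a)"

definition gauss_sum :: "nat \<Rightarrow> (int \<Rightarrow> complex) \<Rightarrow> int \<Rightarrow> complex"
  where "gauss_sum D \<omega> n =
    (\<Sum>\<mu>\<in>{0..<int D}. \<omega> \<mu> * exp (2 * of_real pi * \<i> * of_int n * of_int \<mu> / of_nat D))"

section \<open>The space of modular forms\<close>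

text \<open>Real-analyticity in the two real variables \<open>Re z\<close> and \<open>Im z\<close>: near every point the function is
  the sum of an (absolutely) convergent power series in these variables.\<close>

definition real_analytic_on :: "(complex \<Rightarrow> complex) \<Rightarrow> complex set \<Rightarrow> bool"
    (infix "real'_analytic'_on" 50)
  where "F real_analytic_on U \<longleftrightarrow>
    (\<forall>z\<in>U. \<exists>\<epsilon>>0. \<exists>c :: nat \<Rightarrow> nat \<Rightarrow> complex. \<forall>h. norm h < \<epsilon> \<longrightarrow>
       ((\<lambda>(m, n). c m n * of_real (Re h ^ m * Im h ^ n)) has_sum F (z + h)) UNIV)"

text \<open>\<open>q_pow x z\<close> is the power \<open>q\<^sup>x\<close> of \<open>q = exp (2 \<pi> i z)\<close>, in the branch \<open>exp (2 \<pi> i x z)\<close>;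
  its conjugate is the corresponding power of the conjugate of q.\<close>

definition q_pow :: "real \<Rightarrow> complex \<Rightarrow> complex"
  where "q_pow x z = exp (2 * of_real pi * \<i> * of_real x * z)"

definition M_shriek :: "int \<Rightarrow> int \<Rightarrow> nat \<Rightarrow> (int \<Rightarrow> complex) \<Rightarrow> (complex \<Rightarrow> complex) set"
  where "M_shriek r s N \<psi> = {F.
    F real_analytic_on upper_half_plane \<and>
    (\<forall>\<gamma>\<in>Gamma0 N. \<forall>z\<in>upper_half_plane.
       F (mat_act (map_matrix real_of_int \<gamma>) z) =
         \<psi> (\<gamma> $ 2 $ 2) * aut_factor (map_matrix real_of_int \<gamma>) z powi r
           * aut_factor (map_matrix real_of_int \<gamma>) (cnj z) powi s * F z) \<and>
    (\<exists>(N\<^sub>0 :: nat) (N\<^sub>1 :: nat) (a :: int \<Rightarrow> int \<Rightarrow> int \<Rightarrow> complex). \<forall>z\<in>upper_half_plane.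
       (\<forall>j\<in>{- int N\<^sub>0..int N\<^sub>0}.
          (\<lambda>(m, n). a j m n * q_pow (of_int m) z * cnj (q_pow (of_int n) z))
            summable_on ({- int N\<^sub>1..} \<times> {- int N\<^sub>1..})) \<and>
       F z = (\<Sum>j\<in>{- int N\<^sub>0..int N\<^sub>0}. of_real (Im z) powi j *
                (\<Sum>\<^sub>\<infinity>(m, n)\<in>{- int N\<^sub>1..} \<times> {- int N\<^sub>1..}.
                   a j m n * q_pow (of_int m) z * cnj (q_pow (of_int n) z)))) \<and>
    (\<forall>\<gamma>\<in>SL2Z. \<exists>C>0. \<exists>K. \<exists>Y>0. \<forall>x y. y \<ge> Y \<longrightarrow>
       norm (slash r s (map_matrix real_of_int \<gamma>) F (Complex x y)) \<le> K * exp (C * y))}"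

section \<open>Expansions and twists\<close>

text \<open>An \<open>expansion\<close> records the data of a formal expansion
  \[ \sum_{k \in S} \sum_{n \ge n_0} y^k \alpha_n^{(k)} q^{n/M}
     + \sum_{k \in S} \sum_{n \ge n_0} y^k \beta_n^{(k)} \bar q^{n/M}, \]
  namely M, S, \<open>n\<^sub>0\<close>, and the coefficients, as functions of k and n in this order. The test function
  spaces and L-series below are attached to these data rather than to the function represented,
  because the function does not determine them (for n = 0 only the sum of the two coefficients is
  determined).\<close>

record expansion =
  width :: nat
  exponents :: "int set"
  start :: int
  hol_coeff :: "int \<Rightarrow> int \<Rightarrow> complex"
  antihol_coeff :: "int \<Rightarrow> int \<Rightarrow> complex"

definition has_expansion :: "(complex \<Rightarrow> complex) \<Rightarrow> expansion \<Rightarrow> bool"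
    (infix "has'_expansion" 50)
  where "H has_expansion E \<longleftrightarrow>
    width E > 0 \<and> finite (exponents E) \<and>
    (\<forall>z\<in>upper_half_plane.
       (\<forall>k\<in>exponents E.
          (\<lambda>n. hol_coeff E k n * q_pow (of_int n / of_nat (width E)) z)
             summable_on {start E..} \<and>
          (\<lambda>n. antihol_coeff E k n * cnj (q_pow (of_int n / of_nat (width E)) z))
             summable_on {start E..}) \<and>
       H z = (\<Sum>k\<in>exponents E. of_real (Im z) powi k * (\<Sum>\<^sub>\<infinity>n\<in>{start E..}.
                hol_coeff E k n * q_pow (of_int n / of_nat (width E)) z))
           + (\<Sum>k\<in>exponents E. of_real (Im z) powi k * (\<Sum>\<^sub>\<infinity>n\<in>{start E..}.
                antihol_coeff E k n * cnj (q_pow (of_int n / of_nat (width E)) z))))"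

definition coeffs_subexponential :: "expansion \<Rightarrow> bool"
  where "coeffs_subexponential E \<longleftrightarrow>
    (\<exists>C>0. \<exists>t>1. \<forall>k\<in>exponents E.
       (\<lambda>n::nat. hol_coeff E k (int n)) \<in> O(\<lambda>n. of_real (exp (C * real n powr (1 / t)))) \<and>
       (\<lambda>n::nat. antihol_coeff E k (int n)) \<in> O(\<lambda>n. of_real (exp (C * real n powr (1 / t)))))"

definition twist ::
    "int \<Rightarrow> int \<Rightarrow> nat \<Rightarrow> (int \<Rightarrow> complex) \<Rightarrow> (complex \<Rightarrow> complex) \<Rightarrow> complex \<Rightarrow> complex"
  where "twist r s D \<omega> H z =
    of_real (real D powr (of_int (r + s) / 2)) *
    (\<Sum>\<mu>\<in>{0..<int D}. cnj (\<omega> \<mu>) *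
       slash r s (mat2 (real D powr (- 1 / 2)) (of_int \<mu> * real D powr (- 1 / 2))
                       0 (real D powr (1 / 2))) H z)"

text \<open>The expansion of the twist of a function with an expansion E of width 1; see
  \<open>has_expansion_twist\<close> below.\<close>

definition twist_expansion :: "nat \<Rightarrow> (int \<Rightarrow> complex) \<Rightarrow> expansion \<Rightarrow> expansion"
  where "twist_expansion D \<omega> E =
    \<lparr> width = D, exponents = exponents E, start = start E,
      hol_coeff = (\<lambda>k n. of_nat D powi (- k) * gauss_sum D (conj_character \<omega>) n
                           * hol_coeff E k n),
      antihol_coeff = (\<lambda>k n. of_nat D powi (- k) * cnj (gauss_sum D \<omega> n)
                           * antihol_coeff E k n) \<rparr>"

section \<open>Test functions and L-series\<close>

text \<open>Piecewise smoothness on an interval I allows jumps: every compact subinterval has a finite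
  subdivision such that, on each open piece, the function is the restriction of a function which is
  infinitely differentiable on the closed piece (with one-sided derivatives at the end points).
  The values at the points of the subdivision are arbitrary.\<close>

definition smooth_up_to_ends :: "real \<Rightarrow> real \<Rightarrow> (real \<Rightarrow> complex) \<Rightarrow> bool"
  where "smooth_up_to_ends u v \<phi> \<longleftrightarrow>
    (\<exists>d :: nat \<Rightarrow> real \<Rightarrow> complex. (\<forall>x\<in>{u<..<v}. d 0 x = \<phi> x) \<and>
       (\<forall>n. \<forall>x\<in>{u..v}. (d n has_vector_derivative d (Suc n) x) (at x within {u..v})))"

definition piecewise_smooth_on :: "(real \<Rightarrow> complex) \<Rightarrow> real set \<Rightarrow> bool"
    (infix "piecewise'_smooth'_on" 50)
  where "\<phi> piecewise_smooth_on I \<longleftrightarrow>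
    (\<forall>a b. a < b \<and> {a..b} \<subseteq> I \<longrightarrow>
       (\<exists>(m :: nat) (t :: nat \<Rightarrow> real). t 0 = a \<and> t m = b \<and>
          (\<forall>i<m. t i < t (Suc i) \<and> smooth_up_to_ends (t i) (t (Suc i)) \<phi>)))"

definition laplace :: "(real \<Rightarrow> complex) \<Rightarrow> complex \<Rightarrow> complex"
  where "laplace \<phi> s = (LINT t:{0<..}|lborel. exp (- (s * of_real t)) * \<phi> t)"

text \<open>The Laplace transform of the absolute value of \<open>\<phi>\<close>, as an extended nonnegative number.\<close>

definition laplace_abs :: "(real \<Rightarrow> complex) \<Rightarrow> real \<Rightarrow> ennreal"
  where "laplace_abs \<phi> x = (\<integral>\<^sup>+t\<in>{0<..}. ennreal (exp (- (x * t)) * norm (\<phi> t)) \<partial>lborel)"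

text \<open>\<open>times_power k \<phi>\<close> is the function usually denoted by \<open>\<phi>\<close> with index k + 1.\<close>

definition times_power :: "int \<Rightarrow> (real \<Rightarrow> complex) \<Rightarrow> real \<Rightarrow> complex"
  where "times_power k \<phi> y = of_real y powi k * \<phi> y"

text \<open>Only the restriction of a test function to the positive reals matters, so piecewise smoothness
  is required there; this makes sense of membership also for \<open>slash_Fricke a N \<phi>\<close>, which is only
  meaningful on the positive reals. In the sum, a vanishing coefficient contributes 0 even if the
  Laplace transform next to it is infinite.\<close>

definition test_space :: "expansion \<Rightarrow> (real \<Rightarrow> complex) set"
  where "test_space E = {\<phi>. \<phi> piecewise_smooth_on {0<..} \<and>
    (\<forall>s. Re s \<ge> 2 * pi * of_int (start E) \<longrightarrow>
       set_integrable lborel {0<..} (\<lambda>t. exp (- (s * of_real t)) * \<phi> t)) \<and>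
    (\<Sum>k\<in>exponents E. \<Sum>\<^sub>\<infinity>n\<in>{start E..}.
       ennreal (norm (hol_coeff E k n) + norm (antihol_coeff E k n))
         * laplace_abs (times_power k \<phi>) (2 * pi * of_int n / of_nat (width E))) < \<infinity>}"

definition L_series :: "expansion \<Rightarrow> (real \<Rightarrow> complex) \<Rightarrow> complex"
  where "L_series E \<phi> =
    (\<Sum>k\<in>exponents E. \<Sum>\<^sub>\<infinity>n\<in>{start E..}. hol_coeff E k n
       * laplace (times_power k \<phi>) (2 * of_real pi * of_int n / of_nat (width E)))
    + (\<Sum>k\<in>exponents E. \<Sum>\<^sub>\<infinity>n\<in>{start E..}. antihol_coeff E k n
       * laplace (times_power k \<phi>) (2 * of_real pi * of_int n / of_nat (width E)))"

text \<open>Here E and E' are the expansions of F and of its image under the Fricke involution.\<close>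

definition joint_test_space ::
    "int \<Rightarrow> int \<Rightarrow> nat \<Rightarrow> nat \<Rightarrow> expansion \<Rightarrow> expansion \<Rightarrow> (real \<Rightarrow> complex) set"
  where "joint_test_space r s N D E E' =
    (\<Inter>\<omega>\<in>{\<omega>. dirichlet_character D \<omega>}.
       {\<phi> \<in> test_space (twist_expansion D \<omega> E).
          slash_Fricke (2 - r - s) N \<phi> \<in> test_space (twist_expansion D (conj_character \<omega>) E')})"

section \<open>The expansion of a twist\<close>

lemma twist_eq:
  assumes "D > 0"
  shows "twist r s D \<omega> H z = (\<Sum>\<mu>\<in>{0..<int D}. cnj (\<omega> \<mu>) * H ((z + of_int \<mu>) / of_nat D))"
proof -
  define u where "u = real D powr (1/2)"
  have u: "u > 0" "u * u = real D"
    using assms by (simp_all add: u_def flip: powr_add)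
  have iu: "real D powr (-1/2) = 1 / u"
    by (simp add: u_def powr_minus_divide)
  have Du: "complex_of_real u * complex_of_real u = of_nat D"
    using u(2) by (metis of_real_mult of_real_of_nat_eq)
  have *: "real D powr (of_int (r + s) / 2) = u powi (r + s)"
  proof -
    have "real D powr (of_int (r + s) / 2) = u powr of_int (r + s)"
      by (simp add: u_def powr_powr mult.commute)
    also have "\<dots> = u powi (r + s)"
      using u powr_real_of_int' [of u "r + s"] by simp
    finally show ?thesis .
  qed
  have act: "(of_real (1/u) * z + of_real (of_int \<mu> * (1/u))) / of_real u
               = (z + of_int \<mu>) / of_nat D" for \<mu> :: int
    using u by (simp add: field_simps flip: Du)
  have "of_real u powi (r + s) * (complex_of_real u powi (- r) * complex_of_real u powi (- s)) = 1"
    using u by (simp add: power_int_add power_int_minus field_simps)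
  then show ?thesis
    unfolding twist_def slash_def aut_factor_def mat_act_def moebius_def sum_distrib_left iu
      u_def [symmetric] * det_2
    using u act by (intro sum.cong refl) (simp add: mult_ac)
qed

lemma q_pow_shift:
  assumes "D > 0"
  shows "q_pow (of_int n) ((z + of_int \<mu>) / of_nat D) =
    exp (2 * of_real pi * \<i> * of_int n * of_int \<mu> / of_nat D) * q_pow (of_int n / of_nat D) z"
  using assms by (simp add: q_pow_def field_simps flip: exp_add)

lemma has_sum_finite_sum:
  fixes f :: "'a \<Rightarrow> 'b \<Rightarrow> complex"
  assumes "finite I" and "\<And>i. i \<in> I \<Longrightarrow> (f i has_sum S i) A"
  shows "((\<lambda>x. \<Sum>i\<in>I. f i x) has_sum (\<Sum>i\<in>I. S i)) A"
  using assms by (induction I rule: finite_induct) (auto intro: has_sum_add)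

lemma has_sum_twist:
  assumes D: "D > 0"
    and summable: "\<And>\<mu>. (\<lambda>n. c n * q_pow (of_int n) ((z + of_int \<mu>) / of_nat D)) summable_on A"
  shows "((\<lambda>n. d * gauss_sum D \<omega> n * c n * q_pow (of_int n / of_nat D) z) has_sum
            d * (\<Sum>\<mu>\<in>{0..<int D}. \<omega> \<mu> *
              (\<Sum>\<^sub>\<infinity>n\<in>A. c n * q_pow (of_int n) ((z + of_int \<mu>) / of_nat D)))) A"
proof -
  have "((\<lambda>n. d * (\<Sum>\<mu>\<in>{0..<int D}. \<omega> \<mu> *
           (c n * q_pow (of_int n) ((z + of_int \<mu>) / of_nat D)))) has_sum
         d * (\<Sum>\<mu>\<in>{0..<int D}. \<omega> \<mu> *
           (\<Sum>\<^sub>\<infinity>n\<in>A. c n * q_pow (of_int n) ((z + of_int \<mu>) / of_nat D)))) A"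
    by (intro has_sum_cmult_right has_sum_finite_sum has_sum_infsum summable finite_atLeastLessThan_int)
  then show ?thesis
    by (rule has_sum_cong [THEN iffD1, rotated])
       (simp add: q_pow_shift [OF D] gauss_sum_def sum_distrib_left sum_distrib_right mult_ac)
qed

lemma has_sum_twist_cnj:
  assumes D: "D > 0"
    and summable: "\<And>\<mu>. (\<lambda>n. c n * cnj (q_pow (of_int n) ((z + of_int \<mu>) / of_nat D))) summable_on A"
  shows "((\<lambda>n. d * cnj (gauss_sum D \<omega> n) * c n * cnj (q_pow (of_int n / of_nat D) z)) has_sum
            d * (\<Sum>\<mu>\<in>{0..<int D}. cnj (\<omega> \<mu>) *
              (\<Sum>\<^sub>\<infinity>n\<in>A. c n * cnj (q_pow (of_int n) ((z + of_int \<mu>) / of_nat D))))) A"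
proof -
  have "((\<lambda>n. d * (\<Sum>\<mu>\<in>{0..<int D}. cnj (\<omega> \<mu>) *
           (c n * cnj (q_pow (of_int n) ((z + of_int \<mu>) / of_nat D))))) has_sum
         d * (\<Sum>\<mu>\<in>{0..<int D}. cnj (\<omega> \<mu>) *
           (\<Sum>\<^sub>\<infinity>n\<in>A. c n * cnj (q_pow (of_int n) ((z + of_int \<mu>) / of_nat D))))) A"
    by (intro has_sum_cmult_right has_sum_finite_sum has_sum_infsum summable finite_atLeastLessThan_int)
  then show ?thesis
    by (rule has_sum_cong [THEN iffD1, rotated])
       (simp add: q_pow_shift [OF D] gauss_sum_def sum_distrib_left sum_distrib_right mult_ac)
qed

theorem has_expansion_twist:
  assumes H: "H has_expansion E" and E: "width E = 1" and D: "D > 0"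
  shows "twist r s D \<omega> H has_expansion twist_expansion D \<omega> E"
proof -
  let ?S = "exponents E" and ?A = "{start E..}"
  let ?a = "hol_coeff E" and ?b = "antihol_coeff E"
  let ?q = "\<lambda>z \<mu> n. q_pow (of_int n) ((z + of_int \<mu>) / of_nat D)"
  have fin: "finite ?S"
    using H by (simp add: has_expansion_def)
  have Im_pos: "0 < Im ((z + of_int \<mu>) / of_nat D)" if "0 < Im z" for z and \<mu> :: int
    using that D by simp
  have summable: "(\<lambda>n. ?a k n * ?q z \<mu> n) summable_on ?A"
                 "(\<lambda>n. ?b k n * cnj (?q z \<mu> n)) summable_on ?A"
    if "0 < Im z" "k \<in> ?S" for z k \<mu>
    using H that Im_pos [OF that(1), of \<mu>] unfolding has_expansion_def E by auto
  have eq: "H ((z + of_int \<mu>) / of_nat D) =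
      (\<Sum>k\<in>?S. of_real (Im z) powi k * (of_nat D powi (- k) *
         (\<Sum>\<^sub>\<infinity>n\<in>?A. ?a k n * ?q z \<mu> n))) +
      (\<Sum>k\<in>?S. of_real (Im z) powi k * (of_nat D powi (- k) *
         (\<Sum>\<^sub>\<infinity>n\<in>?A. ?b k n * cnj (?q z \<mu> n))))"
    if "0 < Im z" for z \<mu>
  proof -
    have "complex_of_real (Im ((z + of_int \<mu>) / of_nat D)) powi k =
            of_real (Im z) powi k * of_nat D powi (- k)" for k
      by (simp add: power_int_divide_distrib power_int_minus field_simps)
    then show ?thesis
      using H Im_pos [OF that, of \<mu>] unfolding has_expansion_def E
      by (simp add: mult.assoc)
  qed
  have swap: "(\<Sum>\<mu>\<in>M. x \<mu> * (\<Sum>k\<in>?S. u k * (v k * w k \<mu>))) =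
              (\<Sum>k\<in>?S. u k * (v k * (\<Sum>\<mu>\<in>M. x \<mu> * w k \<mu>)))"
    for M :: "int set" and x :: "int \<Rightarrow> complex" and u v w
    unfolding sum_distrib_left by (subst sum.swap) (simp add: mult_ac)
  show ?thesis
    unfolding has_expansion_def
  proof (intro conjI ballI)
    fix z assume "z \<in> upper_half_plane"
    then have z: "0 < Im z" by simp
    note hol = has_sum_twist [OF D summable(1) [OF z], where \<omega> = "conj_character \<omega>"]
    note anti = has_sum_twist_cnj [OF D summable(2) [OF z], where \<omega> = \<omega>]
    show "twist r s D \<omega> H z = (\<Sum>k\<in>exponents (twist_expansion D \<omega> E). of_real (Im z) powi k *
        (\<Sum>\<^sub>\<infinity>n\<in>{start (twist_expansion D \<omega> E)..}. hol_coeff (twist_expansion D \<omega> E) k n *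
           q_pow (of_int n / of_nat (width (twist_expansion D \<omega> E))) z))
      + (\<Sum>k\<in>exponents (twist_expansion D \<omega> E). of_real (Im z) powi k *
        (\<Sum>\<^sub>\<infinity>n\<in>{start (twist_expansion D \<omega> E)..}. antihol_coeff (twist_expansion D \<omega> E) k n *
           cnj (q_pow (of_int n / of_nat (width (twist_expansion D \<omega> E))) z)))"
      unfolding twist_eq [OF D] eq [OF z] distrib_left sum.distrib swap
      by (simp add: twist_expansion_def infsumI [OF hol] infsumI [OF anti])
    fix k assume "k \<in> exponents (twist_expansion D \<omega> E)"
    then have k: "k \<in> ?S" by (simp add: twist_expansion_def)
    show "(\<lambda>n. hol_coeff (twist_expansion D \<omega> E) k n *
        q_pow (of_int n / of_nat (width (twist_expansion D \<omega> E))) z)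
        summable_on {start (twist_expansion D \<omega> E)..}"
      using has_sum_imp_summable [OF hol [OF k]] by (simp add: twist_expansion_def)
    show "(\<lambda>n. antihol_coeff (twist_expansion D \<omega> E) k n *
        cnj (q_pow (of_int n / of_nat (width (twist_expansion D \<omega> E))) z))
        summable_on {start (twist_expansion D \<omega> E)..}"
      using has_sum_imp_summable [OF anti [OF k]] by (simp add: twist_expansion_def)
  qed (use fin D in \<open>auto simp: twist_expansion_def\<close>)
qed

end

theory Submission
  imports Defs "HOL-Number_Theory.Residues"
begin

text \<open>For a test function \<open>\<phi>\<close>, interchanging sum and integral gives
  \<open>L_H(\<phi>) = \<integral>\<^sub>0\<^sup>\<infinity> H(iy) \<phi>(y) dy\<close>. For \<open>\<mu>\<close> prime to D choose \<open>\<kappa>\<close> and \<open>\<nu>\<close> with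
  \<open>D \<nu> = 1 + \<kappa> N \<mu>\<close>. The element of \<open>\<Gamma>\<^sub>0(N)\<close> with rows \<open>(D, -\<mu>)\<close> and \<open>(-\<kappa> N, \<nu>)\<close> sends
  \<open>(z + \<mu>) / D\<close> to the image of \<open>(-1/(N z) + \<kappa>) / D\<close> under the Fricke involution. Summing
  over \<open>\<mu>\<close> expresses the twist of F at z through the conjugate twist of G at \<open>-1/(N z)\<close>, and the
  functional equation follows by substituting \<open>y = 1/(N x)\<close> in the integral. The test function
  space is non-empty because it contains the zero function.\<close>

section \<open>Dirichlet characters\<close>

lemma dirichlet_character_cong:
  assumes \<omega>: "dirichlet_character n \<omega>" and ab: "[a = b] (mod int n)"
  shows "\<omega> a = \<omega> b"
proof -
  have per: "\<omega> (a + int n) = \<omega> a" for a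
    using \<omega> by (simp add: dirichlet_character_def)
  \<comment> \<open>The defining periodicity moves by a single period, so arbitrary integer
    multiples need induction in both directions from 0.\<close>
  have "\<omega> (a + int n * k) = \<omega> a" for a k
  proof (induction k rule: int_induct [where k = 0])
    case (step1 i)
    then show ?case using per [of "a + int n * i"] by (simp add: algebra_simps)
  next
    case (step2 i)
    then show ?case using per [of "a + int n * (i - 1)"] by (simp add: algebra_simps)
  qed simp
  then show ?thesis
    using ab by (metis cong_iff_lin)
qed

lemma dirichlet_character_1:
  assumes "dirichlet_character n \<omega>"
  shows "\<omega> 1 = 1"
proof -
  have "\<omega> 1 \<noteq> 0" and "\<omega> (1 * 1) = \<omega> 1 * \<omega> 1"
    using assms unfolding dirichlet_character_def by (simp, blast)
  then show ?thesis
    by simp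
qed

lemma dirichlet_character_mult:
  "dirichlet_character n \<omega> \<Longrightarrow> \<omega> (a * b) = \<omega> a * \<omega> b"
  by (simp add: dirichlet_character_def)

lemma dirichlet_character_mult_eq_1:
  assumes "dirichlet_character n \<omega>" and "[a * b = 1] (mod int n)"
  shows "\<omega> a * \<omega> b = 1"
  using dirichlet_character_cong [OF assms] dirichlet_character_mult [OF assms(1), of a b]
    dirichlet_character_1 [OF assms(1)] by simp

text \<open>Euler's theorem makes the value a root of unity: its power with exponent
  \<open>totient n\<close> is 1. Reducing \<open>a\<close> to a natural representative
  \<open>b\<close> first puts the congruence in the form covered by
  \<open>euler_theorem\<close>.\<close>

lemma norm_dirichlet_character:
  assumes \<omega>: "dirichlet_character n \<omega>" and a: "coprime a (int n)"
  shows "norm (\<omega> a) = 1"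
proof -
  have n: "n > 0"
    using \<omega> by (simp add: dirichlet_character_def)
  have pow: "\<omega> (a ^ m) = \<omega> a ^ m" for m
    by (induction m)
       (simp_all add: dirichlet_character_1 [OF \<omega>] dirichlet_character_mult [OF \<omega>])
  define b where "b = nat (a mod int n)"
  have b: "int b = a mod int n"
    using n by (simp add: b_def)
  have "coprime (int b) (int n)"
    using a n unfolding b by (simp add: coprime_mod_left_iff)
  then have "[b ^ totient n = 1] (mod n)"
    by (intro euler_theorem) (simp add: coprime_commute)
  then have "[int b ^ totient n = 1] (mod int n)"
    by (metis cong_int_iff of_nat_1 of_nat_power)
  moreover have "[a ^ totient n = int b ^ totient n] (mod int n)"
    unfolding b by (intro cong_pow) (simp add: cong_def)
  ultimately have "\<omega> (a ^ totient n) = 1"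
    using dirichlet_character_cong [OF \<omega>] dirichlet_character_1 [OF \<omega>] cong_trans by metis
  then have "norm (\<omega> a) ^ totient n = 1"
    by (simp add: pow flip: norm_power)
  moreover have "totient n > 0"
    using n by simp
  ultimately show ?thesis
    using power_eq_imp_eq_base [of "norm (\<omega> a)" "totient n" 1] by simp
qed

text \<open>Nonzero values lie on the unit circle, where conjugation is inversion, and the inverse
  of a value is the value at the inverse residue.\<close>

lemma cnj_dirichlet_character:
  assumes \<omega>: "dirichlet_character n \<omega>" and ab: "[a * b = 1] (mod int n)"
  shows "cnj (\<omega> a) = \<omega> b"
proof -
  have 1: "\<omega> a * \<omega> b = 1"
    by (rule dirichlet_character_mult_eq_1 [OF \<omega> ab])
  then have "coprime a (int n)"
    using \<omega> unfolding dirichlet_character_def by force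
  then have "cnj (\<omega> a) * \<omega> a = 1"
    using norm_dirichlet_character [OF \<omega>] by (metis complex_norm_square mult.commute of_real_1 one_power2)
  with 1 show ?thesis
    by (metis mult.assoc mult.left_neutral mult.right_neutral)
qed

section \<open>Twists and the Fricke involution\<close>

text \<open>The Fricke matrix has determinant 1 and automorphy factor \<open>sqrt N * u\<close>; the
  two weights together leave the power \<open>- r - s\<close> of the square root.\<close>

lemma slash_Fricke_matrix:
  assumes N: "N > 0"
  shows "slash r s (Fricke N) F u =
    of_real (sqrt N) powi (- r - s) * u powi (- r) * cnj u powi (- s) * F (- 1 / (of_nat N * u))"
proof -
  have q: "real N powr (1/2) = sqrt N"
    using N by (simp add: powr_half_sqrt)
  have q': "real N powr - (1/2) = 1 / sqrt N"
    using N by (simp add: powr_minus_divide powr_half_sqrt)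
  have sq: "complex_of_real (sqrt N) * complex_of_real (sqrt N) = of_nat N"
    by (metis of_nat_0_le_iff of_real_mult of_real_of_nat_eq real_sqrt_mult_self abs_of_nonneg)
  have nz: "complex_of_real (sqrt N) \<noteq> 0" using N by simp
  have det: "det (Fricke N) = 1"
    using N by (simp add: Fricke_def det_2 q q')
  have act: "mat_act (Fricke N) u = - 1 / (of_nat N * u)"
    using N by (simp add: mat_act_def moebius_def Fricke_def q q' flip: sq)
  have "aut_factor (Fricke N) u = of_real (sqrt N) * u" for u
    by (simp add: aut_factor_def Fricke_def q)
  then show ?thesis
    using nz unfolding slash_def det act
    by (simp add: power_int_mult_distrib power_int_diff power_int_minus field_simps)
qed

text \<open>The congruence matrix sends \<open>\<zeta>\<close> to the Fricke image of
  \<open>u\<close>, so the law for \<open>F\<close> compares both values. The automorphy factor at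
  \<open>\<zeta>\<close> is \<open>v / D\<close>, and \<open>u\<close> has numerator
  \<open>v\<close> and denominator \<open>- N D z\<close>; hence \<open>v\<close> and
  \<open>D\<close> cancel in both weights and only powers of \<open>N\<close>, \<open>- z\<close>
  and \<open>- cnj z\<close> survive.\<close>

lemma slash_Fricke_shift:
  fixes \<mu> \<nu> \<kappa> :: int
  assumes N: "N > 0" and D: "D > 0" and z: "0 < Im z"
    and F: "\<And>\<gamma> z. \<gamma> \<in> Gamma0 N \<Longrightarrow> 0 < Im z \<Longrightarrow>
       F (mat_act (map_matrix real_of_int \<gamma>) z) =
         \<psi> (\<gamma> $ 2 $ 2) * aut_factor (map_matrix real_of_int \<gamma>) z powi r
           * aut_factor (map_matrix real_of_int \<gamma>) (cnj z) powi s * F z"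
    and \<nu>: "int D * \<nu> = 1 + \<kappa> * int N * \<mu>"
  shows "slash r s (Fricke N) F ((- 1 / (of_nat N * z) + of_int \<kappa>) / of_nat D) =
    \<psi> \<nu> * of_real (sqrt N) powi (r + s) * (- z) powi r * (- cnj z) powi s
      * F ((z + of_int \<mu>) / of_nat D)"
proof -
  define \<gamma> :: "int ^ 2 ^ 2" where "\<gamma> = mat2 (int D) (- \<mu>) (- \<kappa> * int N) \<nu>"
  define \<zeta> where "\<zeta> = (z + of_int \<mu>) / of_nat D"
  define u where "u = (- 1 / (of_nat N * z) + of_int \<kappa>) / of_nat D"
  define v where "v = 1 - of_int \<kappa> * of_nat N * z"
  have z0: "z \<noteq> 0" using z by auto
  have N0: "of_nat N \<noteq> (0::complex)" and D0: "of_nat D \<noteq> (0::complex)"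
    using N D by auto
  \<comment> \<open>The imaginary part of \<open>v\<close> vanishes only for
    \<open>\<kappa> = 0\<close>, and then \<open>v = 1\<close>.\<close>
  have v0: "v \<noteq> 0"
  proof
    assume "v = 0"
    then have "Im v = 0" "Re v = 0" by auto
    with z N show False by (auto simp: v_def)
  qed
  have \<nu>c: "of_nat D * complex_of_int \<nu> = 1 + of_int \<kappa> * of_nat N * of_int \<mu>"
    using arg_cong [OF \<nu>, of complex_of_int] by simp
  \<comment> \<open>The determinant is \<open>D * \<nu> - \<kappa> * N * \<mu>\<close>, which is 1
    by the choice of \<open>\<nu>\<close>.\<close>
  have in_Gamma0: "\<gamma> \<in> Gamma0 N"
    using \<nu> by (simp add: \<gamma>_def Gamma0_def det_2 algebra_simps)
  have Im: "0 < Im \<zeta>"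
    using z D by (simp add: \<zeta>_def)
  have entries: "\<gamma> $ 1 $ 1 = int D" "\<gamma> $ 1 $ 2 = - \<mu>" "\<gamma> $ 2 $ 1 = - \<kappa> * int N" "\<gamma> $ 2 $ 2 = \<nu>"
    by (simp_all add: \<gamma>_def)
  have "(- (of_int \<kappa> * of_nat N) * \<zeta> + of_int \<nu>) * of_nat D = v"
  proof -
    have "(- (of_int \<kappa> * of_nat N) * \<zeta> + of_int \<nu>) * of_nat D =
        - (of_int \<kappa> * of_nat N) * (\<zeta> * of_nat D) + of_nat D * of_int \<nu>"
      by (simp add: algebra_simps)
    also have "\<zeta> * of_nat D = z + of_int \<mu>"
      using D0 by (simp add: \<zeta>_def)
    finally show ?thesis
      unfolding \<nu>c by (simp add: v_def algebra_simps)
  qed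
  then have v: "- (of_int \<kappa> * of_nat N) * \<zeta> + of_int \<nu> = v / of_nat D"
    using D0 by (simp add: field_simps)
  have num: "of_nat D * \<zeta> - of_int \<mu> = z"
    using D0 by (simp add: \<zeta>_def)
  have aut: "aut_factor (map_matrix real_of_int \<gamma>) \<zeta> = v / of_nat D"
    using v by (simp add: aut_factor_def entries)
  then have "cnj (aut_factor (map_matrix real_of_int \<gamma>) \<zeta>) = cnj v / of_nat D"
    by simp
  then have aut': "aut_factor (map_matrix real_of_int \<gamma>) (cnj \<zeta>) = cnj v / of_nat D"
    by (simp add: aut_factor_def)
  have act: "mat_act (map_matrix real_of_int \<gamma>) \<zeta> = of_nat D * z / v"
    using v num by (simp add: mat_act_def moebius_def entries)
  have u: "u = v / (of_nat N * (of_nat D * (- z)))"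
    using N0 D0 z0 by (simp add: u_def v_def field_simps)
  have Fu: "F (- 1 / (of_nat N * u)) = \<psi> \<nu> * (v / of_nat D) powi r * (cnj v / of_nat D) powi s * F \<zeta>"
  proof -
    have "- 1 / (of_nat N * u) = of_nat D * z / v"
      using N0 D0 z0 v0 by (simp add: u field_simps)
    then show ?thesis
      using F [OF in_Gamma0 Im] by (simp add: act aut aut' entries)
  qed
  have sq: "of_nat N = complex_of_real (sqrt N) * complex_of_real (sqrt N)"
    by (metis of_nat_0_le_iff of_real_mult of_real_of_nat_eq real_sqrt_mult_self abs_of_nonneg)
  have nz: "complex_of_real (sqrt N) \<noteq> 0" using N by simp
  have r: "u powi (- r) * (v / of_nat D) powi r = (of_nat N * (- z)) powi r"
    using N0 D0 z0 v0 by (simp add: u power_int_minus flip: power_int_inverse power_int_mult_distrib)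
  have s: "cnj u powi (- s) * (cnj v / of_nat D) powi s = (of_nat N * (- cnj z)) powi s"
    using N0 D0 z0 v0 by (simp add: u power_int_minus flip: power_int_inverse power_int_mult_distrib)
  have "slash r s (Fricke N) F u = of_real (sqrt N) powi (- r - s) * \<psi> \<nu>
     * (u powi (- r) * (v / of_nat D) powi r) * (cnj u powi (- s) * (cnj v / of_nat D) powi s) * F \<zeta>"
    unfolding slash_Fricke_matrix [OF N] Fu by (simp only: mult_ac)
  \<comment> \<open>The factors \<open>N powi r\<close> and \<open>N powi s\<close> amount to
    \<open>sqrt N\<close> to the power \<open>2 * (r + s)\<close>, which turns the exponent
    \<open>- r - s\<close> into \<open>r + s\<close>.\<close>
  also have "\<dots> = \<psi> \<nu> * of_real (sqrt N) powi (r + s) * (- z) powi r * (- cnj z) powi s * F \<zeta>"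
    unfolding r s sq power_int_mult_distrib using nz
    by (simp add: power_int_mult_distrib power_int_diff power_int_add power_int_minus field_simps)
  finally show ?thesis
    by (simp add: u_def \<zeta>_def)
qed

text \<open>The summand at \<open>\<mu>\<close> on the left matches the summand on the right at the
  residue inverse to \<open>- N * \<mu>\<close> modulo \<open>D\<close>. This pairing is an
  involution of the units, so it only permutes the sum. It also yields the constants: inverting
  \<open>\<mu>\<close> produces \<open>\<omega> (- N)\<close>, and \<open>D * \<nu>\<close> being 1
  modulo \<open>N\<close> makes \<open>\<psi> (D)\<close> cancel
  \<open>\<psi> \<nu>\<close>.\<close>

lemma twist_Fricke:
  assumes N: "N > 0" and D: "D > 0" and coprime: "coprime D N"
    and \<psi>: "dirichlet_character N \<psi>" and \<omega>: "dirichlet_character D \<omega>" and z: "0 < Im z"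
    and F: "\<And>\<gamma> z. \<gamma> \<in> Gamma0 N \<Longrightarrow> 0 < Im z \<Longrightarrow>
       F (mat_act (map_matrix real_of_int \<gamma>) z) =
         \<psi> (\<gamma> $ 2 $ 2) * aut_factor (map_matrix real_of_int \<gamma>) z powi r
           * aut_factor (map_matrix real_of_int \<gamma>) (cnj z) powi s * F z"
  shows "twist r s D \<omega> F z =
    \<psi> (int D) * \<omega> (- int N) * of_real (sqrt N) powi (- r - s) * (- z) powi (- r) * (- cnj z) powi (- s)
      * twist r s D (conj_character \<omega>) (slash r s (Fricke N) F) (- 1 / (of_nat N * z))"
proof -
  \<comment> \<open>These are the residues at which characters modulo \<open>D\<close> do not
    vanish; for \<open>D = 1\<close> the set is \<open>{0}\<close>.\<close>
  define U where "U = {\<mu> \<in> {0..<int D}. coprime \<mu> (int D)}"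
  define C where "C = \<psi> (int D) * \<omega> (- int N) * of_real (sqrt N) powi (- r - s) * (- z) powi (- r) * (- cnj z) powi (- s)"
  have "\<exists>\<kappa>\<in>{0..<int D}. [\<mu> * (- int N * \<kappa>) = 1] (mod int D)" if "\<mu> \<in> U" for \<mu>
  proof -
    have "coprime (\<mu> * - int N) (int D)"
      using that coprime by (simp add: U_def coprime_commute)
    then obtain x where x: "[\<mu> * - int N * x = 1] (mod int D)"
      using cong_solve_coprime_int by blast
    have "[\<mu> * - int N * (x mod int D) = \<mu> * - int N * x] (mod int D)"
      by (intro cong_mult cong_refl) (simp add: cong_def)
    then have "[\<mu> * (- int N * (x mod int D)) = 1] (mod int D)"
      using x cong_trans by (simp add: mult.assoc) blast
    then show ?thesis
      using D by (intro bexI [of _ "x mod int D"]) auto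
  qed
  then obtain f where f: "\<And>\<mu>. \<mu> \<in> U \<Longrightarrow> f \<mu> \<in> {0..<int D}"
      "\<And>\<mu>. \<mu> \<in> U \<Longrightarrow> [\<mu> * (- int N * f \<mu>) = 1] (mod int D)"
    by metis
  have f': "[f \<mu> * (- int N * \<mu>) = 1] (mod int D)" if "\<mu> \<in> U" for \<mu>
    using f(2) [OF that] by (simp add: mult_ac)
  have fU: "f \<mu> \<in> U" if "\<mu> \<in> U" for \<mu>
  proof -
    have "coprime (f \<mu>) (int D)"
      using f' [OF that] coprime_iff_invertible_int by blast
    then show ?thesis
      using f(1) [OF that] by (simp add: U_def)
  qed
  \<comment> \<open>Both \<open>\<mu>\<close> and \<open>f (f \<mu>)\<close> are inverse to
    \<open>- N * f \<mu>\<close> modulo \<open>D\<close>; since they lie in the same system of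
    representatives, they are equal.\<close>
  have ff: "f (f \<mu>) = \<mu>" if "\<mu> \<in> U" for \<mu>
  proof -
    have "coprime (f \<mu> * - int N) (int D)"
      using fU [OF that] coprime by (simp add: U_def coprime_commute)
    moreover have "[f \<mu> * - int N * f (f \<mu>) = f \<mu> * - int N * \<mu>] (mod int D)"
      using f(2) [OF fU [OF that]] f' [OF that] cong_trans cong_sym unfolding mult.assoc by blast
    ultimately have "[f (f \<mu>) = \<mu>] (mod int D)"
      using cong_mult_lcancel by blast
    then show ?thesis
      using f(1) [OF fU [OF that]] that by (intro cong_less_imp_eq_int) (auto simp: U_def)
  qed
  have summand: "cnj (\<omega> \<mu>) * F ((z + of_int \<mu>) / of_nat D) =
      C * (\<omega> (f \<mu>) * slash r s (Fricke N) F ((- 1 / (of_nat N * z) + of_int (f \<mu>)) / of_nat D))"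
    if \<mu>: "\<mu> \<in> U" for \<mu>
  proof -
    have "int D dvd 1 - \<mu> * (- int N * f \<mu>)"
      using f(2) [OF \<mu>] by (simp add: cong_iff_dvd_diff dvd_diff_commute)
    then have "int D dvd 1 + f \<mu> * int N * \<mu>"
      by (simp add: mult_ac)
    \<comment> \<open>This \<open>\<nu>\<close> completes the matrix of
      \<open>slash_Fricke_shift\<close> with \<open>\<kappa> = f \<mu>\<close>.\<close>
    then obtain \<nu> where "1 + f \<mu> * int N * \<mu> = int D * \<nu>"
      by (rule dvdE)
    note \<nu> = this [symmetric]
    have "[int D * \<nu> = 1] (mod int N)"
      unfolding \<nu> by (simp add: cong_iff_dvd_diff)
    then have 1: "\<psi> (int D) * \<psi> \<nu> = 1"
      by (rule dirichlet_character_mult_eq_1 [OF \<psi>])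
    have 2: "cnj (\<omega> \<mu>) = \<omega> (- int N) * \<omega> (f \<mu>)"
      unfolding cnj_dirichlet_character [OF \<omega> f(2) [OF \<mu>]] by (rule dirichlet_character_mult [OF \<omega>])
    have nz: "complex_of_real (sqrt N) \<noteq> 0" "- z \<noteq> 0" "- cnj z \<noteq> 0"
      using N z by auto
    have 3: "of_real (sqrt N) powi (- r - s) * of_real (sqrt N) powi (r + s) = (1 :: complex)"
      "(- z) powi (- r) * (- z) powi r = 1" "(- cnj z) powi (- s) * (- cnj z) powi s = 1"
      using nz by (simp_all flip: power_int_add)
    let ?Fz = "F ((z + of_int \<mu>) / of_nat D)"
    have shift: "slash r s (Fricke N) F ((- 1 / (of_nat N * z) + of_int (f \<mu>)) / of_nat D) =
        \<psi> \<nu> * of_real (sqrt N) powi (r + s) * (- z) powi r * (- cnj z) powi s * ?Fz"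
      by (rule slash_Fricke_shift [OF N D z _ \<nu>], rule F)
    have "C * (\<omega> (f \<mu>) *
        (\<psi> \<nu> * of_real (sqrt N) powi (r + s) * (- z) powi r * (- cnj z) powi s * ?Fz)) =
      (\<psi> (int D) * \<psi> \<nu>) * (\<omega> (- int N) * \<omega> (f \<mu>)) *
      (of_real (sqrt N) powi (- r - s) * of_real (sqrt N) powi (r + s)) *
      ((- z) powi (- r) * (- z) powi r) * ((- cnj z) powi (- s) * (- cnj z) powi s) * ?Fz"
      unfolding C_def by (simp only: mult_ac)
    also have "\<dots> = cnj (\<omega> \<mu>) * ?Fz"
      unfolding 1 2 3 by simp
    finally show ?thesis
      by (simp only: shift)
  qed
  \<comment> \<open>The parameter \<open>g\<close> serves both twists: conjugation for the one by
    \<open>\<omega>\<close>, the identity for the one by the conjugate character.\<close>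
  have restrict: "(\<Sum>\<mu>\<in>{0..<int D}. g (\<omega> \<mu>) * h \<mu>) = (\<Sum>\<mu>\<in>U. g (\<omega> \<mu>) * h \<mu>)"
    if "g 0 = 0" for g :: "complex \<Rightarrow> complex" and h
    using \<omega> that by (intro sum.mono_neutral_right) (auto simp: U_def dirichlet_character_def)
  have "twist r s D \<omega> F z = (\<Sum>\<mu>\<in>U. cnj (\<omega> \<mu>) * F ((z + of_int \<mu>) / of_nat D))"
    unfolding twist_eq [OF D] by (rule restrict) simp
  also have "\<dots> = (\<Sum>\<kappa>\<in>U. C * (\<omega> \<kappa> * slash r s (Fricke N) F ((- 1 / (of_nat N * z) + of_int \<kappa>) / of_nat D)))"
    by (rule sum.reindex_bij_witness [where i = f and j = f]) (simp_all add: ff fU summand)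
  also have "\<dots> = C * (\<Sum>\<kappa>\<in>{0..<int D}. \<omega> \<kappa> * slash r s (Fricke N) F ((- 1 / (of_nat N * z) + of_int \<kappa>) / of_nat D))"
    by (simp add: restrict [of "\<lambda>x. x"] sum_distrib_left)
  finally show ?thesis
    by (simp add: twist_eq [OF D] C_def)
qed

section \<open>L-series as integrals\<close>

lemma bij_betw_int_atLeast: "bij_betw (\<lambda>i. n + int i) UNIV {n..}"
  by (rule bij_betwI [where g = "\<lambda>m. nat (m - n)"]) auto

lemma infsum_int_atLeast:
  fixes f :: "int \<Rightarrow> 'a::banach"
  assumes "(\<lambda>m. norm (f m)) summable_on {n..}"
  shows "(\<lambda>i. norm (f (n + int i))) summable_on UNIV"
    and "infsum f {n..} = (\<Sum>i. f (n + int i))"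
proof -
  show abs: "(\<lambda>i. norm (f (n + int i))) summable_on UNIV"
    using assms summable_on_reindex_bij_betw [OF bij_betw_int_atLeast, of "\<lambda>m. norm (f m)" n] by simp
  have "((\<lambda>i. f (n + int i)) has_sum (\<Sum>\<^sub>\<infinity>i. f (n + int i))) UNIV"
    by (intro has_sum_infsum) (rule Infinite_Sum.abs_summable_summable [OF abs])
  then have "(\<Sum>\<^sub>\<infinity>i. f (n + int i)) = (\<Sum>i. f (n + int i))"
    by (intro sums_unique has_sum_imp_sums)
  then show "infsum f {n..} = (\<Sum>i. f (n + int i))"
    using infsum_reindex_bij_betw [OF bij_betw_int_atLeast, of f n] by simp
qed

lemma infsum_int_atLeast_ennreal:
  fixes f :: "int \<Rightarrow> ennreal"
  shows "infsum f {n..} = (\<Sum>i. f (n + int i))"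
proof -
  have "((\<lambda>i. f (n + int i)) has_sum (\<Sum>\<^sub>\<infinity>i. f (n + int i))) UNIV"
    by (intro has_sum_infsum nonneg_summable_on_complete) simp
  then have "(\<Sum>\<^sub>\<infinity>i. f (n + int i)) = (\<Sum>i. f (n + int i))"
    by (intro sums_unique has_sum_imp_sums)
  then show ?thesis
    using infsum_reindex_bij_betw [OF bij_betw_int_atLeast, of f n] by simp
qed

text \<open>The L1 norms of the terms have a finite total, so sum and integral may be exchanged.
  After the shift to natural indices this is \<open>integrable_suminf\<close> and
  \<open>integral_suminf\<close>.\<close>

lemma integral_infsum:
  fixes f :: "int \<Rightarrow> 'a \<Rightarrow> complex"
  assumes int: "\<And>m. integrable M (f m)"
    and pw: "\<And>x. x \<in> space M \<Longrightarrow> (\<lambda>m. f m x) summable_on {n..}"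
    and fin: "(\<Sum>\<^sub>\<infinity>m\<in>{n..}. \<integral>\<^sup>+ x. norm (f m x) \<partial>M) < \<infinity>"
  shows "integrable M (\<lambda>x. \<Sum>\<^sub>\<infinity>m\<in>{n..}. f m x)"
    and "(\<integral>x. (\<Sum>\<^sub>\<infinity>m\<in>{n..}. f m x) \<partial>M) = (\<Sum>\<^sub>\<infinity>m\<in>{n..}. \<integral>x. f m x \<partial>M)"
proof -
  define g where "g i = f (n + int i)" for i
  have nn: "(\<integral>\<^sup>+ x. norm (f m x) \<partial>M) = ennreal (\<integral>x. norm (f m x) \<partial>M)" for m
    using int by (intro nn_integral_eq_integral) auto
  have summ: "summable (\<lambda>i. \<integral>x. norm (g i x) \<partial>M)"
    using fin unfolding infsum_int_atLeast_ennreal nn g_def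
    by (intro summable_suminf_not_top) auto
  \<comment> \<open>For complex terms unconditional summability is already absolute
    summability.\<close>
  have abs: "(\<lambda>m. norm (f m x)) summable_on {n..}" if "x \<in> space M" for x
    using pw [OF that] by (simp add: summable_on_iff_abs_summable_on_complex)
  have AE: "AE x in M. summable (\<lambda>i. norm (g i x))"
    using infsum_int_atLeast(1) [OF abs] unfolding g_def
    by (intro AE_I2 summable_on_imp_summable) simp
  have eq: "(\<Sum>\<^sub>\<infinity>m\<in>{n..}. f m x) = (\<Sum>i. g i x)" if "x \<in> space M" for x
    using infsum_int_atLeast(2) [OF abs [OF that]] by (simp add: g_def)
  have g: "integrable M (g i)" for i
    by (simp add: g_def int)
  show "integrable M (\<lambda>x. \<Sum>\<^sub>\<infinity>m\<in>{n..}. f m x)"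
    using integrable_suminf [OF g AE summ] eq
    by (simp cong: Bochner_Integration.integrable_cong)
  \<comment> \<open>The norms of the integrals are dominated by the L1 norms; this absolute
    summability identifies the unconditional sum of the integrals with the ordinary series.\<close>
  have "(\<lambda>m. norm (\<integral>x. f m x \<partial>M)) summable_on {n..}"
  proof -
    have "summable (\<lambda>i. norm (\<integral>x. g i x \<partial>M))"
      by (rule summable_comparison_test' [OF summ, of 0]) (simp add: integral_norm_bound)
    then have "(\<lambda>i. norm (\<integral>x. g i x \<partial>M)) summable_on UNIV"
      by (intro norm_summable_imp_summable_on) simp
    then show ?thesis
      using summable_on_reindex_bij_betw [OF bij_betw_int_atLeast, of "\<lambda>m. norm (\<integral>x. f m x \<partial>M)" n]
      by (simp add: g_def)
  qed
  then have "(\<Sum>\<^sub>\<infinity>m\<in>{n..}. \<integral>x. f m x \<partial>M) = (\<Sum>i. \<integral>x. g i x \<partial>M)"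
    by (simp add: infsum_int_atLeast(2) g_def)
  also have "\<dots> = (\<integral>x. (\<Sum>i. g i x) \<partial>M)"
    by (rule integral_suminf [OF g AE summ, symmetric])
  finally show "(\<integral>x. (\<Sum>\<^sub>\<infinity>m\<in>{n..}. f m x) \<partial>M) = (\<Sum>\<^sub>\<infinity>m\<in>{n..}. \<integral>x. f m x \<partial>M)"
    using eq by (simp cong: Bochner_Integration.integral_cong)
qed

text \<open>The finiteness hypothesis says exactly that the L1 norms of the terms
  \<open>c n * exp (- (x n * y)) * g y\<close> on the positive half-line have a finite sum, so the
  series may be integrated termwise.\<close>

lemma laplace_series:
  fixes g :: "real \<Rightarrow> complex" and x :: "int \<Rightarrow> real" and c :: "int \<Rightarrow> complex"
  assumes g: "set_borel_measurable lborel {0<..} g"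
    and pw: "\<And>y. y > 0 \<Longrightarrow> (\<lambda>n. c n * of_real (exp (- (x n * y)))) summable_on {n\<^sub>0..}"
    and fin: "(\<Sum>\<^sub>\<infinity>n\<in>{n\<^sub>0..}. ennreal (norm (c n)) * laplace_abs g (x n)) < \<infinity>"
  shows "set_integrable lborel {0<..} (\<lambda>y. (\<Sum>\<^sub>\<infinity>n\<in>{n\<^sub>0..}. c n * of_real (exp (- (x n * y)))) * g y)"
    and "(LINT y:{0<..}|lborel. (\<Sum>\<^sub>\<infinity>n\<in>{n\<^sub>0..}. c n * of_real (exp (- (x n * y)))) * g y) =
         (\<Sum>\<^sub>\<infinity>n\<in>{n\<^sub>0..}. c n * laplace g (of_real (x n)))"
proof -
  define h where "h y = indicator {0<..} y *\<^sub>R g y" for y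
  have h [measurable]: "h \<in> borel_measurable borel"
    using g by (simp add: set_borel_measurable_def h_def [abs_def])
  \<comment> \<open>The cut-off below \<open>n\<^sub>0\<close> is there because
    \<open>integral_infsum\<close> asks for integrability at every index, while \<open>fin\<close>
    controls only the indices from \<open>n\<^sub>0\<close> on.\<close>
  define f where "f n y = (if n < n\<^sub>0 then 0 else c n * of_real (exp (- (x n * y))) * h y)" for n y
  have nn: "(\<integral>\<^sup>+ y. norm (f n y) \<partial>lborel) = ennreal (norm (c n)) * laplace_abs g (x n)" if "n \<ge> n\<^sub>0" for n
  proof -
    have "(\<integral>\<^sup>+ y. norm (f n y) \<partial>lborel) =
        (\<integral>\<^sup>+ y. ennreal (norm (c n)) * ennreal (exp (- (x n * y)) * norm (h y)) \<partial>lborel)"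
      using that by (intro nn_integral_cong) (simp add: f_def norm_mult mult.assoc ennreal_mult)
    also have "\<dots> = ennreal (norm (c n)) * (\<integral>\<^sup>+ y. ennreal (exp (- (x n * y)) * norm (h y)) \<partial>lborel)"
      by (rule nn_integral_cmult) measurable
    also have "(\<integral>\<^sup>+ y. ennreal (exp (- (x n * y)) * norm (h y)) \<partial>lborel) = laplace_abs g (x n)"
      unfolding laplace_abs_def by (intro nn_integral_cong) (simp add: h_def indicator_def)
    finally show ?thesis .
  qed
  have fin': "(\<Sum>\<^sub>\<infinity>n\<in>{n\<^sub>0..}. \<integral>\<^sup>+ y. norm (f n y) \<partial>lborel) < \<infinity>"
  proof -
    have "(\<Sum>\<^sub>\<infinity>n\<in>{n\<^sub>0..}. \<integral>\<^sup>+ y. norm (f n y) \<partial>lborel) =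
        (\<Sum>\<^sub>\<infinity>n\<in>{n\<^sub>0..}. ennreal (norm (c n)) * laplace_abs g (x n))"
      by (intro infsum_cong) (simp add: nn)
    with fin show ?thesis
      by (simp only:)
  qed
  have int: "integrable lborel (f n)" for n
  proof (cases "n < n\<^sub>0")
    case False
    then have "n \<in> {n\<^sub>0..}" by simp
    moreover have "(\<lambda>n. \<integral>\<^sup>+ y. norm (f n y) \<partial>lborel) summable_on A" for A
      by (intro nonneg_summable_on_complete) simp
    \<comment> \<open>A single L1 norm is bounded by the whole sum, hence finite.\<close>
    ultimately have "(\<integral>\<^sup>+ y. norm (f n y) \<partial>lborel) \<le> (\<Sum>\<^sub>\<infinity>n\<in>{n\<^sub>0..}. \<integral>\<^sup>+ y. norm (f n y) \<partial>lborel)"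
      using infsum_mono_neutral [of "\<lambda>n. \<integral>\<^sup>+ y. norm (f n y) \<partial>lborel" "{n}"
          "\<lambda>n. \<integral>\<^sup>+ y. norm (f n y) \<partial>lborel" "{n\<^sub>0..}"] by auto
    also note fin'
    finally show ?thesis
      by (intro integrableI_bounded) (simp_all add: f_def [abs_def])
  qed (simp add: f_def [abs_def])
  have pw': "(\<lambda>n. f n y) summable_on {n\<^sub>0..}"
    and sum: "(\<Sum>\<^sub>\<infinity>n\<in>{n\<^sub>0..}. f n y) =
      indicator {0<..} y *\<^sub>R ((\<Sum>\<^sub>\<infinity>n\<in>{n\<^sub>0..}. c n * of_real (exp (- (x n * y)))) * g y)" for y
  proof -
    have "((\<lambda>n. c n * of_real (exp (- (x n * y))) * h y) has_sum
      indicator {0<..} y *\<^sub>R ((\<Sum>\<^sub>\<infinity>n\<in>{n\<^sub>0..}. c n * of_real (exp (- (x n * y)))) * g y)) {n\<^sub>0..}"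
      using has_sum_cmult_left [OF has_sum_infsum [OF pw], of y "g y"]
      by (cases "y > 0") (simp_all add: h_def)
    then have "((\<lambda>n. f n y) has_sum
      indicator {0<..} y *\<^sub>R ((\<Sum>\<^sub>\<infinity>n\<in>{n\<^sub>0..}. c n * of_real (exp (- (x n * y)))) * g y)) {n\<^sub>0..}"
      by (rule has_sum_cong [THEN iffD1, rotated]) (simp add: f_def)
    then show "(\<lambda>n. f n y) summable_on {n\<^sub>0..}" and "(\<Sum>\<^sub>\<infinity>n\<in>{n\<^sub>0..}. f n y) =
      indicator {0<..} y *\<^sub>R ((\<Sum>\<^sub>\<infinity>n\<in>{n\<^sub>0..}. c n * of_real (exp (- (x n * y)))) * g y)"
      by (auto simp: summable_on_def infsumI)
  qed
  show "set_integrable lborel {0<..} (\<lambda>y. (\<Sum>\<^sub>\<infinity>n\<in>{n\<^sub>0..}. c n * of_real (exp (- (x n * y)))) * g y)"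
    using integral_infsum(1) [OF int pw' fin'] by (simp add: set_integrable_def sum)
  have "(\<integral>y. f n y \<partial>lborel) = c n * laplace g (of_real (x n))" if "n \<ge> n\<^sub>0" for n
  proof -
    have "(\<integral>y. f n y \<partial>lborel) =
        (\<integral>y. c n * (indicator {0<..} y *\<^sub>R (exp (- (of_real (x n) * of_real y)) * g y)) \<partial>lborel)"
      using that by (intro Bochner_Integration.integral_cong)
        (simp_all add: f_def h_def indicator_def flip: exp_of_real)
    also have "\<dots> = c n * laplace g (of_real (x n))"
      unfolding laplace_def set_lebesgue_integral_def by (rule integral_mult_right_zero)
    finally show ?thesis .
  qed
  then have "(\<Sum>\<^sub>\<infinity>n\<in>{n\<^sub>0..}. \<integral>y. f n y \<partial>lborel) = (\<Sum>\<^sub>\<infinity>n\<in>{n\<^sub>0..}. c n * laplace g (of_real (x n)))"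
    by (intro infsum_cong) simp
  then show "(LINT y:{0<..}|lborel. (\<Sum>\<^sub>\<infinity>n\<in>{n\<^sub>0..}. c n * of_real (exp (- (x n * y)))) * g y) =
         (\<Sum>\<^sub>\<infinity>n\<in>{n\<^sub>0..}. c n * laplace g (of_real (x n)))"
    using integral_infsum(2) [OF int pw' fin'] by (simp add: set_lebesgue_integral_def sum)
qed

text \<open>Measurability of a test function is read off from the integrability of its Laplace
  integrand at the real point \<open>s = 2 * pi * start E\<close>; multiplying by the inverse
  exponential and by the power, which is continuous on the positive half-line, preserves it.\<close>

lemma set_borel_measurable_times_power:
  assumes "\<phi> \<in> test_space E"
  shows "set_borel_measurable lborel {0<..} (times_power k \<phi>)"
proof -
  define s where "s = complex_of_real (2 * pi * of_int (start E))"
  define f where "f t = indicator {0<..} t *\<^sub>R (exp (- (s * of_real t)) * \<phi> t)" for t :: real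
  have "set_integrable lborel {0<..} (\<lambda>t. exp (- (s * of_real t)) * \<phi> t)"
    using assms by (simp add: test_space_def s_def)
  then have f [measurable]: "f \<in> borel_measurable borel"
    unfolding set_integrable_def f_def by (simp add: borel_measurable_integrable)
  have "(\<lambda>t. (indicator {0<..} t *\<^sub>R of_real t powi k) * (exp (s * of_real t) * f t)) \<in> borel_measurable borel"
  proof -
    have "(\<lambda>t. indicator {0<..} t *\<^sub>R (complex_of_real t powi k)) \<in> borel_measurable borel"
      by (intro borel_measurable_continuous_on_indicator continuous_intros) auto
    then show ?thesis
      by measurable
  qed
  also have "(\<lambda>t. (indicator {0<..} t *\<^sub>R of_real t powi k) * (exp (s * of_real t) * f t)) =
      (\<lambda>t. indicator {0<..} t *\<^sub>R times_power k \<phi> t)"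
    by (auto simp: fun_eq_iff f_def times_power_def indicator_def exp_minus)
  finally show ?thesis
    by (simp add: set_borel_measurable_def)
qed

lemma set_integral_sum:
  fixes f :: "'i \<Rightarrow> 'a \<Rightarrow> 'b::{banach, second_countable_topology}"
  assumes "\<And>i. i \<in> I \<Longrightarrow> set_integrable M A (f i)"
  shows "set_integrable M A (\<lambda>x. \<Sum>i\<in>I. f i x)"
    and "(LINT x:A|M. \<Sum>i\<in>I. f i x) = (\<Sum>i\<in>I. LINT x:A|M. f i x)"
  using assms unfolding set_integrable_def set_lebesgue_integral_def scaleR_sum_right
  by (auto intro: Bochner_Integration.integrable_sum Bochner_Integration.integral_sum)

section \<open>Integrals along the imaginary axis\<close>

lemma q_pow_imaginary:
  "q_pow x (\<i> * of_real y) = of_real (exp (- (2 * pi * x * y)))"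
proof -
  have "2 * of_real pi * \<i> * of_real x * (\<i> * of_real y) = complex_of_real (- (2 * pi * x * y))"
    by (simp add: algebra_simps)
  then show ?thesis
    unfolding q_pow_def by (simp only: exp_of_real)
qed

text \<open>On the imaginary axis the powers of \<open>q\<close> are real, so holomorphic and
  antiholomorphic terms become the same exponentials, whose integrals against
  \<open>times_power k \<phi>\<close> are the Laplace transforms in \<open>L_series\<close>. The
  summability condition of \<open>test_space\<close> is what permits termwise integration.\<close>

lemma L_series_eq_integral:
  assumes H: "H has_expansion E" and \<phi>: "\<phi> \<in> test_space E"
  shows "set_integrable lborel {0<..} (\<lambda>y. H (\<i> * of_real y) * \<phi> y)"
    and "L_series E \<phi> = (LINT y:{0<..}|lborel. H (\<i> * of_real y) * \<phi> y)"
proof -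
  let ?S = "exponents E" and ?A = "{start E..}"
  define x where "x n = 2 * pi * of_int n / real (width E)" for n :: int
  let ?e = "\<lambda>n y. complex_of_real (exp (- (x n * y)))"
  have S: "finite ?S" and w: "width E > 0"
    using H by (simp_all add: has_expansion_def)
  have q: "q_pow (of_int n / of_nat (width E)) (\<i> * of_real y) = ?e n y" for n y
    by (simp add: q_pow_imaginary x_def)
  have q': "cnj (?e n y) = ?e n y" for n y
    by simp
  have pw_hol: "(\<lambda>n. hol_coeff E k n * ?e n y) summable_on ?A"
    and pw_anti: "(\<lambda>n. antihol_coeff E k n * ?e n y) summable_on ?A"
    if "y > 0" "k \<in> ?S" for y k
  proof -
    have "\<i> * of_real y \<in> upper_half_plane"
      using that by simp
    with H that(2) show "(\<lambda>n. hol_coeff E k n * ?e n y) summable_on ?A"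
      and "(\<lambda>n. antihol_coeff E k n * ?e n y) summable_on ?A"
      unfolding has_expansion_def by (auto simp only: q q' dest!: bspec)
  qed
  have eq: "H (\<i> * of_real y) * \<phi> y =
      (\<Sum>k\<in>?S. (\<Sum>\<^sub>\<infinity>n\<in>?A. hol_coeff E k n * ?e n y) * times_power k \<phi> y) +
      (\<Sum>k\<in>?S. (\<Sum>\<^sub>\<infinity>n\<in>?A. antihol_coeff E k n * ?e n y) * times_power k \<phi> y)"
    if "y > 0" for y
  proof -
    have z: "\<i> * of_real y \<in> upper_half_plane" "Im (\<i> * of_real y) = y"
      using that by simp_all
    then have Hy: "H (\<i> * of_real y) =
        (\<Sum>k\<in>?S. of_real y powi k * (\<Sum>\<^sub>\<infinity>n\<in>?A. hol_coeff E k n * ?e n y)) +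
        (\<Sum>k\<in>?S. of_real y powi k * (\<Sum>\<^sub>\<infinity>n\<in>?A. antihol_coeff E k n * ?e n y))"
      using H unfolding has_expansion_def by (metis (no_types, lifting) q q' infsum_cong sum.cong)
    show ?thesis
      unfolding Hy distrib_right sum_distrib_right by (simp only: times_power_def mult_ac)
  qed
  \<comment> \<open>One bound covers both coefficient families, since each is dominated by the sum
    of norms used in \<open>test_space\<close>.\<close>
  have fin: "(\<Sum>\<^sub>\<infinity>n\<in>?A. ennreal (norm (c n)) * laplace_abs (times_power k \<phi>) (x n)) < \<infinity>"
    if k: "k \<in> ?S" and c: "\<And>n. norm (c n) \<le> norm (hol_coeff E k n) + norm (antihol_coeff E k n)"
    for k and c :: "int \<Rightarrow> complex"
  proof -
    let ?f = "\<lambda>k n. ennreal (norm (hol_coeff E k n) + norm (antihol_coeff E k n))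
         * laplace_abs (times_power k \<phi>) (x n)"
    have "(\<Sum>\<^sub>\<infinity>n\<in>?A. ennreal (norm (c n)) * laplace_abs (times_power k \<phi>) (x n)) \<le> (\<Sum>\<^sub>\<infinity>n\<in>?A. ?f k n)"
      by (intro infsum_mono nonneg_summable_on_complete mult_right_mono ennreal_leI c) simp_all
    also have "\<dots> \<le> (\<Sum>k\<in>?S. \<Sum>\<^sub>\<infinity>n\<in>?A. ?f k n)"
      using S k by (intro member_le_sum) auto
    also have "\<dots> < \<infinity>"
      using \<phi> by (simp add: test_space_def x_def)
    finally show ?thesis .
  qed
  note meas = set_borel_measurable_times_power [OF \<phi>]
  have hol: "set_integrable lborel {0<..} (\<lambda>y. (\<Sum>\<^sub>\<infinity>n\<in>?A. hol_coeff E k n * ?e n y) * times_power k \<phi> y)"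
    "(LINT y:{0<..}|lborel. (\<Sum>\<^sub>\<infinity>n\<in>?A. hol_coeff E k n * ?e n y) * times_power k \<phi> y) =
      (\<Sum>\<^sub>\<infinity>n\<in>?A. hol_coeff E k n * laplace (times_power k \<phi>) (of_real (x n)))" if "k \<in> ?S" for k
    using that by (intro laplace_series meas pw_hol fin; simp)+
  have anti: "set_integrable lborel {0<..} (\<lambda>y. (\<Sum>\<^sub>\<infinity>n\<in>?A. antihol_coeff E k n * ?e n y) * times_power k \<phi> y)"
    "(LINT y:{0<..}|lborel. (\<Sum>\<^sub>\<infinity>n\<in>?A. antihol_coeff E k n * ?e n y) * times_power k \<phi> y) =
      (\<Sum>\<^sub>\<infinity>n\<in>?A. antihol_coeff E k n * laplace (times_power k \<phi>) (of_real (x n)))" if "k \<in> ?S" for k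
    using that by (intro laplace_series meas pw_anti fin; simp)+
  have int: "set_integrable lborel {0<..} (\<lambda>y. \<Sum>k\<in>?S. (\<Sum>\<^sub>\<infinity>n\<in>?A. hol_coeff E k n * ?e n y) * times_power k \<phi> y)"
    "set_integrable lborel {0<..} (\<lambda>y. \<Sum>k\<in>?S. (\<Sum>\<^sub>\<infinity>n\<in>?A. antihol_coeff E k n * ?e n y) * times_power k \<phi> y)"
    using hol(1) anti(1) by (auto intro!: set_integral_sum(1))
  have "set_integrable lborel {0<..} (\<lambda>y. H (\<i> * of_real y) * \<phi> y) \<longleftrightarrow> set_integrable lborel {0<..} (\<lambda>y.
      (\<Sum>k\<in>?S. (\<Sum>\<^sub>\<infinity>n\<in>?A. hol_coeff E k n * ?e n y) * times_power k \<phi> y) +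
      (\<Sum>k\<in>?S. (\<Sum>\<^sub>\<infinity>n\<in>?A. antihol_coeff E k n * ?e n y) * times_power k \<phi> y))"
    by (intro set_integrable_cong) (use eq in auto)
  then show "set_integrable lborel {0<..} (\<lambda>y. H (\<i> * of_real y) * \<phi> y)"
    using set_integral_add(1) [OF int] by simp
  have "(LINT y:{0<..}|lborel. H (\<i> * of_real y) * \<phi> y) = (LINT y:{0<..}|lborel.
      (\<Sum>k\<in>?S. (\<Sum>\<^sub>\<infinity>n\<in>?A. hol_coeff E k n * ?e n y) * times_power k \<phi> y) +
      (\<Sum>k\<in>?S. (\<Sum>\<^sub>\<infinity>n\<in>?A. antihol_coeff E k n * ?e n y) * times_power k \<phi> y))"
    by (intro set_lebesgue_integral_cong) (use eq in auto)
  also have "\<dots> = (\<Sum>k\<in>?S. \<Sum>\<^sub>\<infinity>n\<in>?A. hol_coeff E k n * laplace (times_power k \<phi>) (of_real (x n))) +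
      (\<Sum>k\<in>?S. \<Sum>\<^sub>\<infinity>n\<in>?A. antihol_coeff E k n * laplace (times_power k \<phi>) (of_real (x n)))"
    by (simp only: set_integral_add(2) [OF int] set_integral_sum(2) hol anti cong: sum.cong)
  also have "\<dots> = L_series E \<phi>"
    by (simp add: L_series_def x_def)
  finally show "L_series E \<phi> = (LINT y:{0<..}|lborel. H (\<i> * of_real y) * \<phi> y)" ..
qed

text \<open>The map taking \<open>x\<close> to \<open>1 / (c * x)\<close> is a bijection of the
  positive half-line onto itself, with derivative of absolute value
  \<open>1 / (c * x\<^sup>2)\<close>. The change of variables is made for gauge integrals, and the
  two integrability hypotheses translate both sides back.\<close>

lemma set_integral_inversion:
  fixes f :: "real \<Rightarrow> complex" and c :: real
  assumes c: "c > 0" and f: "set_integrable lborel {0<..} f"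
    and g: "set_integrable lborel {0<..} (\<lambda>x. (1 / (c * x\<^sup>2)) *\<^sub>R f (1 / (c * x)))"
  shows "(LINT x:{0<..}|lborel. f x) = (LINT x:{0<..}|lborel. (1 / (c * x\<^sup>2)) *\<^sub>R f (1 / (c * x)))"
proof -
  let ?g = "\<lambda>x::real. 1 / (c * x)"
  have inj: "inj_on ?g {0<..}"
    using c by (auto simp: inj_on_def)
  have "y \<in> ?g ` {0<..}" if "y > 0" for y
    using that c by (intro image_eqI [of _ _ "1 / (c * y)"]) auto
  then have im: "?g ` {0<..} = {0<..}"
    using c by auto
  have abs: "f absolutely_integrable_on {0<..}"
    using f by (simp add: set_integrable_def integrable_completion borel_measurable_integrable)
  have "((\<lambda>x. 1 / (c * x)) has_field_derivative - (1 / (c * x\<^sup>2))) (at x within {0<..})"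
    if "x \<in> {0<..}" for x
    using that c by (auto intro!: derivative_eq_intros simp: power2_eq_square)
  then have "integral {0<..} (\<lambda>x. \<bar>- (1 / (c * x\<^sup>2))\<bar> *\<^sub>R f (?g x)) = integral {0<..} f"
    using has_absolute_integral_change_of_variables_real
      [of "{0<..}" ?g "\<lambda>x. - (1 / (c * x\<^sup>2))" f "integral {0<..} f"] inj abs im by simp
  then show ?thesis
    using c by (simp add: set_borel_integral_eq_integral(2) [OF f] set_borel_integral_eq_integral(2) [OF g])
qed

section \<open>The functional equation\<close>

lemma zero_in_test_space: "(\<lambda>_. 0) \<in> test_space E"
proof -
  have "\<exists>m t. t 0 = a \<and> t m = b \<and>
      (\<forall>i<m. t i < t (Suc i) \<and> smooth_up_to_ends (t i) (t (Suc i)) (\<lambda>_. 0))"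
    if "a < b" for a b :: real
    using that unfolding smooth_up_to_ends_def
    \<comment> \<open>A single piece suffices, with all derivatives zero.\<close>
    by (intro exI [of _ "1 :: nat"] exI [of _ "\<lambda>i::nat. if i = 0 then a else b"])
       (auto intro!: exI [of _ "\<lambda>_ _. 0"])
  then have "(\<lambda>_. 0) piecewise_smooth_on {0<..}"
    by (simp add: piecewise_smooth_on_def)
  moreover have "times_power k (\<lambda>_. 0) = (\<lambda>_. 0)" for k
    by (simp add: times_power_def fun_eq_iff)
  ultimately show ?thesis
    by (simp add: test_space_def laplace_abs_def set_integrable_def)
qed

theorem theorem4p5:
  fixes r s :: int and N D :: nat and \<psi> \<omega> :: "int \<Rightarrow> complex"
    and F G :: "complex \<Rightarrow> complex" and E\<^sub>F E\<^sub>G :: expansion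
  assumes "N > 0" and "D > 0" and "coprime D N"
    and "dirichlet_character N \<psi>" and "dirichlet_character D \<omega>"
    and "\<psi> (- 1) = (- 1) powi (r + s)"
    and "F \<in> M_shriek r s N \<psi>"
    and "F has_expansion E\<^sub>F" and "width E\<^sub>F = 1" and "coeffs_subexponential E\<^sub>F"
    and "G = slash r s (Fricke N) F"
    and "G has_expansion E\<^sub>G" and "width E\<^sub>G = 1" and "coeffs_subexponential E\<^sub>G"
  shows "joint_test_space r s N D E\<^sub>F E\<^sub>G \<noteq> {} \<and>
    (\<forall>\<phi> \<in> joint_test_space r s N D E\<^sub>F E\<^sub>G.
       L_series (twist_expansion D \<omega> E\<^sub>F) \<phi> =
         \<i> powi (r - s) * \<omega> (- int N) * \<psi> (int D)
           / of_real (real N powr (of_int (r + s - 2) / 2))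
         * L_series (twist_expansion D (conj_character \<omega>) E\<^sub>G)
             (slash_Fricke (2 - r - s) N \<phi>))"
proof (intro conjI ballI)
  have "slash_Fricke (2 - r - s) N (\<lambda>_. 0) = (\<lambda>_. 0)"
    by (simp add: slash_Fricke_def fun_eq_iff)
  then have "(\<lambda>_. 0) \<in> joint_test_space r s N D E\<^sub>F E\<^sub>G"
    by (simp add: joint_test_space_def zero_in_test_space)
  then show "joint_test_space r s N D E\<^sub>F E\<^sub>G \<noteq> {}"
    by blast
next
  fix \<phi> assume "\<phi> \<in> joint_test_space r s N D E\<^sub>F E\<^sub>G"
  then have \<phi>: "\<phi> \<in> test_space (twist_expansion D \<omega> E\<^sub>F)"
    and \<phi>': "slash_Fricke (2 - r - s) N \<phi> \<in> test_space (twist_expansion D (conj_character \<omega>) E\<^sub>G)"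
    using assms(5) by (auto simp: joint_test_space_def)
  have N: "N > 0" and D: "D > 0" by fact+
  define f where "f y = twist r s D \<omega> F (\<i> * of_real y) * \<phi> y" for y :: real
  define g where "g y = twist r s D (conj_character \<omega>) G (\<i> * of_real y) * slash_Fricke (2 - r - s) N \<phi> y" for y :: real
  define K where "K = \<i> powi (r - s) * \<omega> (- int N) * \<psi> (int D) / of_real (real N powr (of_int (r + s - 2) / 2))"
  have F: "set_integrable lborel {0<..} f"
      "L_series (twist_expansion D \<omega> E\<^sub>F) \<phi> = (LINT y:{0<..}|lborel. f y)"
    unfolding f_def
    by (rule L_series_eq_integral [OF has_expansion_twist \<phi>]; fact assms)+
  have G: "set_integrable lborel {0<..} g"
      "L_series (twist_expansion D (conj_character \<omega>) E\<^sub>G) (slash_Fricke (2 - r - s) N \<phi>) =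
        (LINT y:{0<..}|lborel. g y)"
    unfolding g_def
    by (rule L_series_eq_integral [OF has_expansion_twist \<phi>']; fact assms)+
  \<comment> \<open>The half-integral power of \<open>N\<close> is rewritten as an integer power of
    its square root, so that all exponents below obey the rules for \<open>powi\<close>.\<close>
  have sqrt: "real N powr (of_int (r + s - 2) / 2) = sqrt N powi (r + s - 2)"
  proof -
    have "real N powr (of_int (r + s - 2) / 2) = (real N powr (1/2)) powr of_int (r + s - 2)"
      by (simp add: powr_powr mult.commute)
    also have "\<dots> = sqrt N powi (r + s - 2)"
      using N powr_real_of_int' [of "sqrt N" "r + s - 2"] by (simp add: powr_half_sqrt)
    finally show ?thesis .
  qed
  \<comment> \<open>The two integrands agree pointwise after the substitution. The automorphy
    factors give degree \<open>r + s\<close> in \<open>x\<close> and the Jacobian lowers it by 2,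
    which is the power carried by \<open>slash_Fricke (2 - r - s) N \<phi>\<close>; the remaining
    powers of \<open>N\<close> make up the denominator of \<open>K\<close>.\<close>
  have fg: "(1 / (real N * x\<^sup>2)) *\<^sub>R f (1 / (real N * x)) = K * g x" if x: "x > 0" for x
  proof -
    define w where "w = complex_of_real (sqrt N)"
    define X where "X = complex_of_real x"
    define z where "z = \<i> * of_real (1 / (real N * x))"
    have nz: "w \<noteq> 0" "X \<noteq> 0"
      using N x by (auto simp: w_def X_def)
    have ww: "of_nat N = w * w"
      unfolding w_def by (metis of_nat_0_le_iff of_real_mult of_real_of_nat_eq real_sqrt_mult_self abs_of_nonneg)
    have z: "z = \<i> / (w * w * X)"
      by (simp add: z_def X_def flip: ww)
    have Im: "0 < Im z"
      using N x by (simp add: z_def)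
    have inv: "- 1 / (of_nat N * z) = \<i> * X"
      using nz by (simp add: ww z field_simps)
    \<comment> \<open>Written this way, the unit \<open>\<i>\<close> sits inside the inverse for
      \<open>- z\<close> and outside it for \<open>- cnj z\<close>. The two weights therefore
      contribute \<open>\<i>\<close> to the powers \<open>r\<close> and \<open>- s\<close>, which
      gives \<open>\<i> powi (r - s)\<close>.\<close>
    have z1: "- z = inverse (\<i> * (w * w * X))" and z2: "- cnj z = \<i> * inverse (w * w * X)"
      using nz by (simp_all add: z field_simps w_def X_def)
    have tr: "twist r s D \<omega> F z = \<psi> (int D) * \<omega> (- int N) * w powi (- r - s) * (- z) powi (- r)
      * (- cnj z) powi (- s) * twist r s D (conj_character \<omega>) G (\<i> * X)"
      using twist_Fricke [OF N D assms(3-5) Im, of F r s] assms(7)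
      unfolding inv w_def assms(11) M_shriek_def by simp
    have p1: "(- z) powi (- r) = \<i> powi r * (w powi r * w powi r * X powi r)"
      by (simp only: z1 power_int_minus power_int_inverse power_int_mult_distrib inverse_inverse_eq)
    have p2: "(- cnj z) powi (- s) = inverse (\<i> powi s) * (w powi s * w powi s * X powi s)"
      by (simp only: z2 power_int_minus power_int_inverse power_int_mult_distrib inverse_inverse_eq inverse_mult_distrib)
    have "w powi (- r - s) * (- z) powi (- r) * (- cnj z) powi (- s) =
        \<i> powi (r - s) * w powi (r + s) * X powi (r + s)"
      unfolding p1 p2 using nz
      by (simp add: power_int_minus power_int_add power_int_diff field_simps)
    then have tr': "twist r s D \<omega> F z = \<psi> (int D) * \<omega> (- int N) *
      (\<i> powi (r - s) * w powi (r + s) * X powi (r + s)) * twist r s D (conj_character \<omega>) G (\<i> * X)"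
      unfolding tr by (simp only: mult.assoc)
    have e: "- (2 - r - s) = r + s - 2"
      by simp
    have sl: "slash_Fricke (2 - r - s) N \<phi> x = (w * w * X) powi (r + s - 2) * \<phi> (1 / (real N * x))"
      unfolding slash_Fricke_def e by (simp add: X_def flip: ww)
    have K: "K = \<i> powi (r - s) * \<omega> (- int N) * \<psi> (int D) / w powi (r + s - 2)"
      unfolding K_def sqrt w_def by simp
    have "(1 / (real N * x\<^sup>2)) *\<^sub>R f (1 / (real N * x)) =
        twist r s D \<omega> F z * \<phi> (1 / (real N * x)) / (w * w * X\<^sup>2)"
      by (simp add: f_def z_def scaleR_conv_of_real X_def flip: ww)
    also have "\<dots> = K * g x"
      unfolding tr' K g_def sl X_def [symmetric] using nz
      by (simp add: power_int_mult_distrib power_int_add power_int_diff field_simps power2_eq_square)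
    finally show ?thesis .
  qed
  \<comment> \<open>Integrability of the substituted integrand is inherited from \<open>g\<close>,
    that is, from the test function condition on the Fricke side.\<close>
  have "set_integrable lborel {0<..} (\<lambda>x. (1 / (real N * x\<^sup>2)) *\<^sub>R f (1 / (real N * x))) \<longleftrightarrow>
      set_integrable lborel {0<..} (\<lambda>x. K * g x)"
    by (intro set_integrable_cong) (simp_all add: fg)
  then have int: "set_integrable lborel {0<..} (\<lambda>x. (1 / (real N * x\<^sup>2)) *\<^sub>R f (1 / (real N * x)))"
    using G(1) by simp
  have "(LINT x:{0<..}|lborel. f x) = (LINT x:{0<..}|lborel. (1 / (real N * x\<^sup>2)) *\<^sub>R f (1 / (real N * x)))"
    using N by (intro set_integral_inversion F(1) int) simp
  also have "\<dots> = (LINT x:{0<..}|lborel. K * g x)"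
    by (intro set_lebesgue_integral_cong) (auto simp: fg)
  also have "\<dots> = K * (LINT x:{0<..}|lborel. g x)"
    by (rule set_integral_mult_right)
  finally show "L_series (twist_expansion D \<omega> E\<^sub>F) \<phi> =
         \<i> powi (r - s) * \<omega> (- int N) * \<psi> (int D)
           / of_real (real N powr (of_int (r + s - 2) / 2))
         * L_series (twist_expansion D (conj_character \<omega>) E\<^sub>G)
             (slash_Fricke (2 - r - s) N \<phi>)"
    by (simp only: F(2) G(2) K_def)
qed

end
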